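(* Let $\Omega=\mathbb{R}$ (except in (ii), where $\Omega=[0,1]$), let $f\colon\mathbb{R}\to\mathbb{R}_+$ be a positive convex function with $f(1)=0$, let $p,q\in\mathcal{P}(\Omega)$, and let $T$ be the monotone mapping function with $T_\#q=p$. The following properties hold. (i) Nonnegativity: $\mathrm{D}_{\mathrm{T},f}(p\|q)\ge 0$. And $\mathrm{D}_{\mathrm{T},f}(p\|q)=0$ if and only if $p$ equals $q$ up to a constant shift in their variables, i.e., there exists a constant $c\in\mathbb{R}$ such that $p(x+c)=q(x)$. (ii) Entropy: let $\Omega=[0,1]$ and $q(x)=1$. Then the transport $f$-divergence equals the following negative entropy: $$\mathrm{D}_{\mathrm{T},f}(p\|1)=\int_\Omega f\Big(\frac{1}{p(x)}\Big)p(x)\,dx .$$ (iii) Additivity and scaling: suppose $f_1,f_2$ are convex functions (of the same kind as $f$) and $a>0$. Then $$\mathrm{D}_{\mathrm{T},f_1+af_2}(p\|q)=\mathrm{D}_{\mathrm{T},f_1}(p\|q)+a\,\mathrm{D}_{\mathrm{T},f_2}(p\|q).$$ (iv) Duality: $\mathrm{D}_{\mathrm{T},f}(p\|q)=\mathrm{D}_{\mathrm{T},\hat f}(q\|p)$, where $\hat f(u)=f(\frac{1}{u})$. (v) Transport invariance: let $k\colon\Omega\to\Omega$ be a smooth invertible mapping function with inverse function $k^{-1}$. Let $\tilde q=(k^{-1})_\#q$ and $\tilde p=\tilde T_\#\tilde q$, with $$\tilde T(x)=\int_0^x T'(k(y))\,dy+c$$ for any constant $c\in\mathbb{R}$. Then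 $\mathrm{D}_{\mathrm{T},f}(p\|q)=\mathrm{D}_{\mathrm{T},f}(\tilde p\|\tilde q)$. (vi) Transport convexity in the first variable: given any densities $p_1,p_2,q\in\mathcal{P}(\Omega)$ with $p_1=(T_1)_\#q$ and $p_2=(T_2)_\#q$, where $T_1,T_2$ are monotone mapping functions, denote $p_\lambda=\big(\lambda T_1+(1-\lambda)T_2\big)_\#q$. Then for any constant $\lambda\in[0,1]$, $$\mathrm{D}_{\mathrm{T},f}(p_\lambda\|q)\le\lambda\,\mathrm{D}_{\mathrm{T},f}(p_1\|q)+(1-\lambda)\,\mathrm{D}_{\mathrm{T},f}(p_2\|q).$$
   Context: $\mathcal{P}(\Omega)=\{p\in C^\infty(\Omega):\int_\Omega p(x)\,dx=1,\ p(x)>0\}$ is the space of smooth positive probability density functions on $\Omega$. For a map $S$, the notation $S_\#q$ denotes the push-forward of the density $q$ by $S$. For densities $p,q$, the monotone mapping function $T$ with $T_\#q=p$ is $T(x)=F_p^{-1}(F_q(x))$, where $F_p,F_q$ are the cumulative distribution functions of $p,q$; it satisfies $p(T(x))\,T'(x)=q(x)$. Definition (transport $f$-divergence): for $p,q\in\mathcal{P}(\Omega)$ and $T$ the monotone mapping function with $T_\#q=p$, $$\mathrm{D}_{\mathrm{T},f}(p\|q)=\int_\Omega f\Big(\frac{q(x)}{p(T(x))}\Big)q(x)\,dx .$$ The same formula with $\hat f$ in place of $f$ defines $\mathrm{D}_{\mathrm{T},\hat f}$.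
   Formalization: "Positive" with f(1)=0 is read as f ≥ 0; in (i), the claim that D=0 forces p and q to agree up to a shift is stated for f with f(u)>0 for all u≠1, since it fails for f=0. *)

theory Defs
  imports "HOL-Probability.Probability"
begin

text \<open>Derivatives are taken within \<open>\<Omega>\<close>, hence one-sided at the endpoints of \<open>\<Omega> = {0..1}\<close>;
  \<open>D n\<close> is the \<open>n\<close>-th derivative of \<open>f\<close>.\<close>

definition smooth_on :: "real set \<Rightarrow> (real \<Rightarrow> real) \<Rightarrow> bool" where
  "smooth_on \<Omega> f \<longleftrightarrow>
    (\<exists>D :: nat \<Rightarrow> real \<Rightarrow> real. (\<forall>x\<in>\<Omega>. D 0 x = f x) \<and>
      (\<forall>n. \<forall>x\<in>\<Omega>. (D n has_real_derivative D (Suc n) x) (at x within \<Omega>)))"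

text \<open>The values of a density outside \<open>\<Omega>\<close> are irrelevant.\<close>

definition smooth_densities :: "real set \<Rightarrow> (real \<Rightarrow> real) set" where
  "smooth_densities \<Omega> =
    {p. smooth_on \<Omega> p \<and> (\<forall>x\<in>\<Omega>. 0 < p x) \<and> (LINT x:\<Omega>|lborel. p x) = 1}"

definition dens_measure :: "real set \<Rightarrow> (real \<Rightarrow> real) \<Rightarrow> real measure" where
  "dens_measure \<Omega> p = density lborel (\<lambda>x. ennreal (indicator \<Omega> x * p x))"

text \<open>\<open>F\<^sub>p\<^sup>-\<^sup>1 \<circ> F\<^sub>q\<close>, where the distribution function \<open>F\<^sub>p\<close> is inverted as a function on \<open>\<Omega>\<close>.\<close>

definition monotone_transport :: "real set \<Rightarrow> (real \<Rightarrow> real) \<Rightarrow> (real \<Rightarrow> real) \<Rightarrow> real \<Rightarrow> real" where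
  "monotone_transport \<Omega> p q x = inv_into \<Omega> (cdf (dens_measure \<Omega> p)) (cdf (dens_measure \<Omega> q) x)"

text \<open>\<open>p = S\<^sub># q\<close> on the real line. Only the measure is determined by \<open>S\<close> and \<open>q\<close>, so any
  nonnegative Borel version \<open>p\<close> of its density is admitted, not only a smooth one.\<close>

definition is_pushforward :: "(real \<Rightarrow> real) \<Rightarrow> (real \<Rightarrow> real) \<Rightarrow> (real \<Rightarrow> real) \<Rightarrow> bool" where
  "is_pushforward S q p \<longleftrightarrow>
    S \<in> borel_measurable borel \<and> p \<in> borel_measurable borel \<and> (\<forall>y. 0 \<le> p y) \<and>
    distr (dens_measure UNIV q) borel S = dens_measure UNIV p"

text \<open>The Lebesgue integral over \<open>\<Omega>\<close> as an extended real. The Bochner integral would silently give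
  a divergent integral the value 0.\<close>

definition ext_integral :: "real set \<Rightarrow> (real \<Rightarrow> real) \<Rightarrow> ereal" where
  "ext_integral \<Omega> g =
    enn2ereal (\<integral>\<^sup>+x\<in>\<Omega>. ennreal (g x) \<partial>lborel) - enn2ereal (\<integral>\<^sup>+x\<in>\<Omega>. ennreal (- g x) \<partial>lborel)"

definition transport_div ::
    "real set \<Rightarrow> (real \<Rightarrow> real) \<Rightarrow> (real \<Rightarrow> real) \<Rightarrow> (real \<Rightarrow> real) \<Rightarrow> ereal" where
  "transport_div \<Omega> f p q = ext_integral \<Omega> (\<lambda>x. f (q x / p (monotone_transport \<Omega> p q x)) * q x)"

text \<open>Nonnegativity does not exclude \<open>f = 0\<close>, for which the divergence vanishes for all \<open>p\<close> and
  \<open>q\<close>; recovering a shift from a vanishing divergence needs \<open>f\<close> to be positive away from 1.\<close>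

definition div_generator :: "(real \<Rightarrow> real) \<Rightarrow> bool" where
  "div_generator f \<longleftrightarrow> convex_on UNIV f \<and> (\<forall>u. 0 \<le> f u) \<and> f 1 = 0"

end

theory Submission
  imports Defs
begin

text \<open>
  The change of variables formula gives \<open>q x / p (T x) = T' x\<close>, so the divergence is the
  \<open>q\<close>-average of \<open>f \<circ> T'\<close>. In this form it only sees the derivative of the transport map: it
  vanishes iff \<open>T' = 1\<close>, i.e. \<open>T\<close> is a shift; duality is the change of variables along
  \<open>T\<^sub># q = p\<close>; invariance holds because the new map has derivative \<open>T' \<circ> k\<close> while \<open>k\<close> pushes
  \<open>(k\<^sup>-\<^sup>1)\<^sub># q\<close> back to \<open>q\<close>; and convexity is that of \<open>f\<close>, because the
  derivative is linear in the map.
\<close>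

subsection \<open>Distribution functions and monotone transport of smooth densities\<close>

lemma smooth_on_imp_continuous_on: "smooth_on \<Omega> f \<Longrightarrow> continuous_on \<Omega> f"
proof -
  assume "smooth_on \<Omega> f"
  then obtain D where D: "\<forall>x\<in>\<Omega>. D 0 x = f x"
    "\<forall>n. \<forall>x\<in>\<Omega>. (D n has_real_derivative D (Suc n) x) (at x within \<Omega>)"
    unfolding smooth_on_def by blast
  have "continuous_on \<Omega> (D 0)"
    by (rule DERIV_continuous_on) (use D in blast)
  then show ?thesis
    using D(1) by (simp cong: continuous_on_cong)
qed

lemma smooth_densitiesD:
  assumes "p \<in> smooth_densities \<Omega>"
  shows "continuous_on \<Omega> p" "x \<in> \<Omega> \<Longrightarrow> 0 < p x" "(LINT x:\<Omega>|lborel. p x) = 1"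
  using assms by (auto simp: smooth_densities_def smooth_on_imp_continuous_on)

lemma borel_measurable_smooth_density:
  assumes "p \<in> smooth_densities \<Omega>" "\<Omega> \<in> sets borel"
  shows "(\<lambda>x. indicator \<Omega> x * p x) \<in> borel_measurable borel"
  using borel_measurable_continuous_on_indicator[OF assms(2) smooth_densitiesD(1)[OF assms(1)]]
  by simp

lemma sets_dens_measure [simp, measurable_cong]: "sets (dens_measure \<Omega> p) = sets borel"
  by (simp add: dens_measure_def)

lemma real_distribution_dens_measure:
  assumes p: "p \<in> smooth_densities \<Omega>" and \<Omega>: "\<Omega> \<in> sets borel"
  shows "real_distribution (dens_measure \<Omega> p)"
proof -
  note [measurable] = borel_measurable_smooth_density[OF assms]
  have 1: "(LINT x|lborel. indicator \<Omega> x * p x) = 1"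
    using smooth_densitiesD(3)[OF p] by (simp add: set_lebesgue_integral_def)
  have nn: "indicator \<Omega> x * p x \<ge> 0" for x
    using smooth_densitiesD(2)[OF p, of x] by (auto simp: indicator_def)
  \<comment> \<open>A nonintegrable function has Bochner integral 0, so the value 1 already forces
    integrability.\<close>
  have "integrable lborel (\<lambda>x. indicator \<Omega> x * p x)"
    using 1 not_integrable_integral_eq by fastforce
  then have "(\<integral>\<^sup>+x. ennreal (indicator \<Omega> x * p x) \<partial>lborel) = 1"
    using nn 1 by (simp add: nn_integral_eq_integral)
  then have "prob_space (dens_measure \<Omega> p)"
    unfolding dens_measure_def by (intro prob_spaceI) (simp add: emeasure_density)
  then show ?thesis
    by (simp add: real_distribution_def real_distribution_axioms_def)
qed

text \<open>A measure with a Lebesgue density has no atoms. This serves the unit interval; on the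
  whole line continuity comes from the derivative computed below.\<close>

lemma isCont_cdf_dens_measure:
  assumes "(\<lambda>x. indicator \<Omega> x * p x) \<in> borel_measurable borel"
    and "real_distribution (dens_measure \<Omega> p)"
  shows "isCont (cdf (dens_measure \<Omega> p)) x"
proof -
  note [measurable] = assms(1)
  interpret real_distribution "dens_measure \<Omega> p" by fact
  have "{x} \<in> null_sets (dens_measure \<Omega> p)"
    unfolding dens_measure_def
  proof (subst null_sets_density_iff, safe)
    show "AE y in lborel. y \<in> {x} \<longrightarrow> ennreal (indicator \<Omega> y * p y) = 0"
      using AE_lborel_singleton[of x] by eventually_elim simp
  qed simp_all
  then show ?thesis
    by (simp add: isCont_cdf measure_eq_0_null_sets)
qed

text \<open>If the interval were null for the density, positivity of \<open>p\<close> on it would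
  make it Lebesgue-null. Strict monotonicity of distribution functions rests on this.\<close>

lemma emeasure_dens_measure_Ioc_pos:
  assumes p: "p \<in> smooth_densities \<Omega>" and \<Omega>: "\<Omega> \<in> sets borel"
    and "a < b" "{a<..b} \<subseteq> \<Omega>"
  shows "emeasure (dens_measure \<Omega> p) {a<..b} > 0"
proof (rule ccontr)
  note [measurable] = borel_measurable_smooth_density[OF p \<Omega>]
  assume "\<not> ?thesis"
  then have "{a<..b} \<in> null_sets (dens_measure \<Omega> p)"
    by (auto simp: null_sets_def)
  then have "AE x in lborel. x \<in> {a<..b} \<longrightarrow> ennreal (indicator \<Omega> x * p x) = 0"
    unfolding dens_measure_def by (subst (asm) null_sets_density_iff) auto
  then have "AE x in lborel. x \<notin> {a<..b}"
  proof eventually_elim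
    case (elim x)
    show ?case
    proof
      assume "x \<in> {a<..b}"
      with assms(4) have "x \<in> \<Omega>" by blast
      with elim \<open>x \<in> {a<..b}\<close> smooth_densitiesD(2)[OF p this] show False
        by (simp add: ennreal_eq_0_iff)
    qed
  qed
  then have "{a<..b} \<in> null_sets lborel"
    by (subst (asm) AE_iff_null_sets[symmetric]) auto
  then show False
    using \<open>a < b\<close> by (auto simp: null_sets_def)
qed

lemma cdf_dens_measure_less:
  assumes p: "p \<in> smooth_densities \<Omega>" and \<Omega>: "\<Omega> \<in> sets borel"
    and "a < b" "{a<..b} \<subseteq> \<Omega>"
  shows "cdf (dens_measure \<Omega> p) a < cdf (dens_measure \<Omega> p) b"
proof -
  interpret real_distribution "dens_measure \<Omega> p"
    by (rule real_distribution_dens_measure[OF p \<Omega>])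
  show ?thesis
    using emeasure_dens_measure_Ioc_pos[OF assms] cdf_diff_eq[OF \<open>a < b\<close>]
    by (simp add: emeasure_eq_measure)
qed

text \<open>Fundamental theorem of calculus: to the right of a base point, the distribution function
  is a constant plus the integral of the continuous density.\<close>

lemma DERIV_cdf_dens_measure:
  assumes p: "p \<in> smooth_densities UNIV"
  shows "(cdf (dens_measure UNIV p) has_real_derivative p x) (at x)"
proof -
  interpret real_distribution "dens_measure UNIV p"
    by (rule real_distribution_dens_measure[OF p]) simp
  note [measurable] = borel_measurable_smooth_density[OF p, simplified]
  \<comment> \<open>Any base point left of \<open>x\<close> would do; it makes \<open>x\<close>
    interior to \<open>{a..x+1}\<close>, so the derivative within that interval is
    two-sided.\<close>
  define a where "a = x - 1"
  have cont: "continuous_on A p" for A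
    using smooth_densitiesD(1)[OF p] continuous_on_subset by blast
  have eq: "cdf (dens_measure UNIV p) t = cdf (dens_measure UNIV p) a + integral {a..t} p"
    if "a < t" for t
  proof -
    have "emeasure (dens_measure UNIV p) {a<..t} = (\<integral>\<^sup>+y. ennreal (p y) * indicator {a<..t} y \<partial>lborel)"
      by (simp add: dens_measure_def emeasure_density)
    also have "\<dots> = (\<integral>\<^sup>+y. ennreal (indicator {a..t} y * p y) \<partial>lborel)"
      by (intro nn_integral_cong_AE)
        (use AE_lborel_singleton[of a] in \<open>auto elim!: eventually_mono simp: indicator_def\<close>)
    also have "\<dots> = integral {a..t} p"
      using smooth_densitiesD(2)[OF p]
      by (intro nn_integral_has_integral_lebesgue integrable_integral integrable_continuous_interval cont)
        (auto intro: less_imp_le)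
    finally have "measure (dens_measure UNIV p) {a<..t} = integral {a..t} p"
      using smooth_densitiesD(2)[OF p]
      by (simp add: measure_def integral_nonneg integrable_continuous_interval cont less_imp_le)
    then show ?thesis
      using cdf_diff_eq[OF that] by simp
  qed
  have "((\<lambda>t. integral {a..t} p) has_real_derivative p x) (at x within {a..x+1})"
    by (rule integral_has_real_derivative) (auto simp: a_def cont)
  then have "((\<lambda>t. cdf (dens_measure UNIV p) a + integral {a..t} p) has_real_derivative p x) (at x)"
    by (subst (asm) at_within_interior) (auto simp: a_def intro!: derivative_eq_intros)
  then show ?thesis
    by (rule has_field_derivative_transform_within_open[where S="{a<..}"]) (auto simp: eq a_def)
qed

lemma cdf_dens_measure_bounds:
  assumes p: "p \<in> smooth_densities UNIV"
  shows "0 < cdf (dens_measure UNIV p) x" "cdf (dens_measure UNIV p) x < 1"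
proof -
  interpret real_distribution "dens_measure UNIV p"
    by (rule real_distribution_dens_measure[OF p]) simp
  show "0 < cdf (dens_measure UNIV p) x"
    using cdf_dens_measure_less[OF p, of "x - 1" x] cdf_nonneg[of "x - 1"] by simp
  show "cdf (dens_measure UNIV p) x < 1"
    using cdf_dens_measure_less[OF p, of x "x + 1"] cdf_bounded_prob[of "x + 1"] by simp
qed

lemma strict_mono_cdf_dens_measure:
  "p \<in> smooth_densities UNIV \<Longrightarrow> strict_mono (cdf (dens_measure UNIV p))"
  by (auto intro!: strict_monoI cdf_dens_measure_less)

text \<open>The limits 0 and 1 at the two ends and the intermediate value theorem give every value
  strictly between; a density that is positive everywhere never attains the limits. Thus all smooth
  densities share one range, and inverting one distribution function at a value of another is
  legitimate.\<close>

lemma range_cdf_dens_measure: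
  assumes p: "p \<in> smooth_densities UNIV"
  shows "range (cdf (dens_measure UNIV p)) = {0<..<1}"
proof (intro equalityI subsetI)
  fix u :: real assume u: "u \<in> {0<..<1}"
  interpret real_distribution "dens_measure UNIV p"
    by (rule real_distribution_dens_measure[OF p]) simp
  let ?F = "cdf (dens_measure UNIV p)"
  have "eventually (\<lambda>x. ?F x < u) at_bot"
    using u by (intro order_tendstoD(2)[OF cdf_lim_at_bot]) auto
  then obtain a where a: "?F a < u"
    by (auto simp: eventually_at_bot_linorder)
  have "eventually (\<lambda>x. u < ?F x) at_top"
    using u by (intro order_tendstoD(1)[OF cdf_lim_at_top_prob]) auto
  then obtain b where b: "u < ?F b"
    by (auto simp: eventually_at_top_linorder)
  have "a \<le> b"
    using a b cdf_nondecreasing[of b a] by linarith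
  then have "\<exists>x\<ge>a. x \<le> b \<and> ?F x = u"
    using a b DERIV_isCont[OF DERIV_cdf_dens_measure[OF p]] by (intro IVT) auto
  then show "u \<in> range ?F"
    by blast
qed (use cdf_dens_measure_bounds[OF p] in auto)

lemma monotone_transport_eqI:
  assumes "cdf (dens_measure \<Omega> p) y = cdf (dens_measure \<Omega> q) x" "y \<in> \<Omega>"
    and "\<And>z. z \<in> \<Omega> \<Longrightarrow> cdf (dens_measure \<Omega> p) z = cdf (dens_measure \<Omega> q) x \<Longrightarrow> z = y"
  shows "monotone_transport \<Omega> p q x = y"
  unfolding monotone_transport_def inv_into_def by (rule some_equality) (use assms in blast)+

context
  fixes p q :: "real \<Rightarrow> real"
  assumes p: "p \<in> smooth_densities UNIV" and q: "q \<in> smooth_densities UNIV"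
begin

lemma cdf_monotone_transport:
  "cdf (dens_measure UNIV p) (monotone_transport UNIV p q x) = cdf (dens_measure UNIV q) x"
  unfolding monotone_transport_def
  using range_cdf_dens_measure[OF p] range_cdf_dens_measure[OF q] by (intro f_inv_into_f) auto

lemma monotone_transport_unique:
  "cdf (dens_measure UNIV p) y = cdf (dens_measure UNIV q) x \<Longrightarrow> monotone_transport UNIV p q x = y"
  using strict_mono_eq[OF strict_mono_cdf_dens_measure[OF p]] cdf_monotone_transport by metis

text \<open>Inverse function rule for \<open>?F\<close> followed by the chain rule with
  \<open>?G\<close>; this identifies the argument of \<open>f\<close> in the divergence as the
  derivative of the transport map.\<close>

lemma DERIV_monotone_transport:
  "(monotone_transport UNIV p q has_real_derivative q x / p (monotone_transport UNIV p q x)) (at x)"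
proof -
  let ?F = "cdf (dens_measure UNIV p)" and ?G = "cdf (dens_measure UNIV q)"
  have inv: "inv ?F (?F y) = y" for y
    by (simp add: inv_f_f strict_mono_imp_inj_on strict_mono_cdf_dens_measure[OF p])
  have "isCont (inv ?F) (?F (monotone_transport UNIV p q x))"
    by (rule isCont_inverse_function2[of "monotone_transport UNIV p q x - 1" _ "monotone_transport UNIV p q x + 1"])
      (auto simp: inv intro: DERIV_isCont[OF DERIV_cdf_dens_measure[OF p]])
  \<comment> \<open>The bounds 0 and 1 delimit the range of \<open>?F\<close>: on this open
    interval, which contains \<open>?G x\<close>, \<open>inv ?F\<close> is a right inverse of
    \<open>?F\<close>.\<close>
  then have "DERIV (inv ?F) (?G x) :> inverse (p (monotone_transport UNIV p q x))"
    using DERIV_cdf_dens_measure[OF p] smooth_densitiesD(2)[OF p] cdf_dens_measure_bounds[OF q]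
      range_cdf_dens_measure[OF p]
    by (intro DERIV_inverse_function[where f="?F" and a=0 and b=1])
      (auto simp: cdf_monotone_transport less_imp_neq[THEN not_sym] monotone_transport_def f_inv_into_f)
  from DERIV_chain2[OF this DERIV_cdf_dens_measure[OF q, of x]]
  show ?thesis
    by (simp add: monotone_transport_def[abs_def] divide_inverse mult.commute)
qed

lemma continuous_on_monotone_transport: "continuous_on A (monotone_transport UNIV p q)"
  by (meson DERIV_monotone_transport DERIV_isCont continuous_at_imp_continuous_on)

lemma monotone_transport_less_iff:
  "monotone_transport UNIV p q x < monotone_transport UNIV p q y \<longleftrightarrow> x < y"
  using strict_mono_less[OF strict_mono_cdf_dens_measure[OF p]]
    strict_mono_less[OF strict_mono_cdf_dens_measure[OF q]] cdf_monotone_transport by metis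

end

lemma monotone_transport_inverse:
  assumes "p \<in> smooth_densities UNIV" "q \<in> smooth_densities UNIV"
  shows "monotone_transport UNIV q p (monotone_transport UNIV p q x) = x"
  by (rule monotone_transport_unique) (simp_all add: assms cdf_monotone_transport)

text \<open>\<open>R\<close> acts as a generalized inverse of \<open>S\<close>: the preimage of
  \<open>{..y}\<close> is \<open>{..R y}\<close> up to a null set, and distribution functions
  determine measures. The exceptional null set is what lets the criterion apply on the unit
  interval.\<close>

lemma distr_eqI_cdf:
  assumes M: "real_distribution M" and N: "real_distribution N"
    and S: "S \<in> borel_measurable borel"
    and S_le: "\<And>y. AE x in M. S x \<le> y \<longleftrightarrow> x \<le> R y"
    and cdf: "\<And>y. cdf M (R y) = cdf N y"
  shows "distr M borel S = N"
proof (rule cdf_unique)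
  interpret M: real_distribution M by fact
  note [measurable] = S
  show "real_distribution (distr M borel S)"
    by (intro M.real_distribution_distr) simp
  show "cdf (distr M borel S) = cdf N"
  proof
    fix y
    have "cdf (distr M borel S) y = measure M {x. S x \<le> y}"
      by (simp add: cdf_def measure_distr vimage_def)
    also have "\<dots> = measure M {..R y}"
      by (rule M.finite_measure_eq_AE) (use S_le[of y] in auto)
    finally show "cdf (distr M borel S) y = cdf N y"
      using cdf by (simp add: cdf_def)
  qed
qed (rule N)

lemma distr_monotone_transport:
  assumes p: "p \<in> smooth_densities UNIV" and q: "q \<in> smooth_densities UNIV"
  shows "distr (dens_measure UNIV q) borel (monotone_transport UNIV p q) = dens_measure UNIV p"
proof (rule distr_eqI_cdf[where R="monotone_transport UNIV q p"])
  show "AE x in dens_measure UNIV q.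
    monotone_transport UNIV p q x \<le> y \<longleftrightarrow> x \<le> monotone_transport UNIV q p y" for y
    using monotone_transport_less_iff[OF p q, of "monotone_transport UNIV q p y"]
    by (simp add: monotone_transport_inverse[OF q p] not_less[symmetric])
qed (auto intro: real_distribution_dens_measure p q cdf_monotone_transport
    borel_measurable_continuous_onI continuous_on_monotone_transport)

section \<open>The divergence as a nonnegative integral\<close>

lemma ext_integral_nonneg:
  "(\<And>x. x \<in> \<Omega> \<Longrightarrow> 0 \<le> g x) \<Longrightarrow>
    ext_integral \<Omega> g = enn2ereal (\<integral>\<^sup>+x\<in>\<Omega>. ennreal (g x) \<partial>lborel)"
proof -
  assume g: "\<And>x. x \<in> \<Omega> \<Longrightarrow> 0 \<le> g x"
  have "(\<integral>\<^sup>+x\<in>\<Omega>. ennreal (- g x) \<partial>lborel) = (\<integral>\<^sup>+x. 0 \<partial>(lborel :: real measure))"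
    by (intro nn_integral_cong) (use g in \<open>auto simp: indicator_def ennreal_neg\<close>)
  then show ?thesis
    by (simp add: ext_integral_def zero_ennreal.rep_eq)
qed

lemma nn_integral_dens_measure_UNIV:
  assumes [measurable]: "q \<in> borel_measurable borel" "g \<in> borel_measurable borel"
    and "\<And>x. 0 \<le> q x" "\<And>x. 0 \<le> g x"
  shows "(\<integral>\<^sup>+x. ennreal (g x) \<partial>dens_measure UNIV q) = (\<integral>\<^sup>+x. ennreal (g x * q x) \<partial>lborel)"
  using assms(3,4) by (simp add: dens_measure_def nn_integral_density ennreal_mult mult.commute)

text \<open>A finite convex function on the whole line is continuous, which supplies
  measurability.\<close>

lemma div_generatorD:
  assumes "div_generator f"
  shows "continuous_on A f" "f \<in> borel_measurable borel" "0 \<le> f u" "f 1 = 0"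
proof -
  have "continuous_on UNIV f"
    using assms by (intro convex_on_continuous) (auto simp: div_generator_def)
  then show "continuous_on A f" "f \<in> borel_measurable borel"
    by (auto intro: continuous_on_subset borel_measurable_continuous_onI)
qed (use assms in \<open>auto simp: div_generator_def\<close>)

text \<open>The integrand is nonnegative, so the difference of extended integrals collapses to one
  nonnegative integral against \<open>q\<close>; later identities then hold for infinite values too.
  Convexity of \<open>f\<close> is not assumed because duality applies this to
  \<open>\<lambda>u. f (1 / u)\<close>, which can fail to be convex.\<close>

lemma transport_div_smooth:
  assumes p: "p \<in> smooth_densities UNIV" and q: "q \<in> smooth_densities UNIV"
    and [measurable]: "f \<in> borel_measurable borel" and f: "\<And>u. 0 \<le> f u"
  shows "transport_div UNIV f p q =
    enn2ereal (\<integral>\<^sup>+x. ennreal (f (q x / p (monotone_transport UNIV p q x))) \<partial>dens_measure UNIV q)"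
proof -
  have [measurable]: "p \<in> borel_measurable borel" "q \<in> borel_measurable borel"
    "monotone_transport UNIV p q \<in> borel_measurable borel"
    by (intro borel_measurable_continuous_onI continuous_on_monotone_transport
        smooth_densitiesD(1)[OF p] smooth_densitiesD(1)[OF q] p q)+
  show ?thesis
    using f smooth_densitiesD(2)[OF q] less_imp_le unfolding transport_div_def
    by (subst ext_integral_nonneg) (auto simp: nn_integral_dens_measure_UNIV less_imp_le)
qed

text \<open>Compact intervals form an intersection-stable generator, and the intervals from
  \<open>- real n\<close> to \<open>real n\<close> exhaust the line. Compact intervals are chosen
  because the substitution rule for integrals is stated on them.\<close>

lemma real_measure_eqI_Icc:
  fixes M N :: "real measure"
  assumes "sets M = sets borel" "sets N = sets borel"
    and eq: "\<And>a b. a \<le> b \<Longrightarrow> emeasure M {a..b} = emeasure N {a..b}"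
    and fin: "\<And>a b. emeasure M {a..b} \<noteq> \<infinity>"
  shows "M = N"
proof (rule measure_eqI_generator_eq)
  let ?E = "range (\<lambda>(a, b). {a..b::real})"
  show "Int_stable ?E"
  proof (rule Int_stableI, clarify)
    fix a b c d :: real
    show "{a..b} \<inter> {c..d} \<in> ?E"
      by (rule image_eqI[where x="(max a c, min b d)"]) auto
  qed
  show "sets M = sigma_sets UNIV ?E" "sets N = sigma_sets UNIV ?E"
    by (simp_all add: assms(1,2) borel_eq_atLeastAtMost)
  show "emeasure M X = emeasure N X" if "X \<in> ?E" for X
  proof -
    obtain a b where "X = {a..b}"
      using \<open>X \<in> ?E\<close> by auto
    then show ?thesis
      by (cases "a \<le> b") (simp_all add: eq)
  qed
  show "range (\<lambda>n. {- real n..real n}) \<subseteq> ?E"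
    by auto
  show "(\<Union>n. {- real n..real n}) = UNIV"
  proof (intro equalityI subsetI UN_iff[THEN iffD2])
    fix x :: real
    obtain n where "\<bar>x\<bar> \<le> real n"
      using real_arch_simple by blast
    then show "\<exists>n\<in>UNIV. x \<in> {- real n..real n}"
      by (intro bexI[of _ n]) (auto simp: abs_le_iff)
  qed simp
  show "emeasure M {- real n..real n} \<noteq> \<infinity>" for n
    by (rule fin)
qed simp

subsection \<open>Push-forward along an increasing map\<close>

context
  fixes p q S S' :: "real \<Rightarrow> real"
  assumes q [measurable]: "q \<in> borel_measurable borel" and q_nonneg: "\<And>x. 0 \<le> q x"
    and q_dist: "real_distribution (dens_measure UNIV q)"
    and q_cdf: "strict_mono (cdf (dens_measure UNIV q))"
    and S: "\<And>x. (S has_real_derivative S' x) (at x)"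
    and S'_pos: "\<And>x. 0 < S' x" and S'_cont: "continuous_on UNIV S'"
    and push: "is_pushforward S q p"
begin

lemma pushforward_less_iff: "S x < S y \<longleftrightarrow> x < y"
proof -
  have "strict_mono S"
    by (rule strict_monoI) (metis DERIV_pos_imp_increasing S S'_pos)
  then show ?thesis
    by (rule strict_mono_less)
qed

lemma pushforward_le_iff: "S x \<le> S y \<longleftrightarrow> x \<le> y"
  using pushforward_less_iff[of y x] by (simp add: not_less[symmetric])

lemma pushforward_measurable:
  "S \<in> borel_measurable borel" "p \<in> borel_measurable borel" "S' \<in> borel_measurable borel"
  using push S'_cont by (auto simp: is_pushforward_def intro: borel_measurable_continuous_onI)

lemma dens_measure_pushforward:
  "dens_measure UNIV p = distr (dens_measure UNIV q) borel S"
  using push by (simp add: is_pushforward_def)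

lemma cdf_pushforward:
  "cdf (dens_measure UNIV p) (S x) = cdf (dens_measure UNIV q) x"
  unfolding dens_measure_pushforward using pushforward_measurable(1)
  by (simp add: cdf_def measure_distr vimage_def pushforward_le_iff atMost_def)

text \<open>\<open>S\<close> need not be onto, so the distribution function of \<open>p\<close> may fail to be injective,
  but it attains each value of the distribution function of \<open>q\<close> only once.\<close>

lemma monotone_transport_pushforward: "monotone_transport UNIV p q x = S x"
proof (rule monotone_transport_eqI)
  interpret q: real_distribution "dens_measure UNIV q" by (rule q_dist)
  interpret p: real_distribution "dens_measure UNIV p"
    unfolding dens_measure_pushforward
    by (intro q.real_distribution_distr) (simp add: pushforward_measurable)
  let ?F = "cdf (dens_measure UNIV p)" and ?G = "cdf (dens_measure UNIV q)"
  fix z assume z: "?F z = ?G x"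
  have cont: "isCont S x"
    using S by (rule DERIV_isCont)
  show "z = S x"
  proof (rule ccontr)
    assume "z \<noteq> S x"
    then consider "S x < z" | "z < S x"
      by linarith
    then show False
    proof cases
      case 1
      \<comment> \<open>By continuity some \<open>t\<close> right of \<open>x\<close> still has
        \<open>S t < z\<close>, but \<open>?G\<close> has already grown strictly from
        \<open>x\<close> to \<open>t\<close>, so \<open>?F z\<close> exceeds \<open>?G x\<close>.
        The other case is symmetric.\<close>
      then have "eventually (\<lambda>t. S t < z) (at_right x)"
        using cont by (intro order_tendstoD(2)[of _ "S x"]) (auto simp: isCont_def intro: tendsto_within_subset)
      then obtain b where "x < b" and b: "\<And>t. x < t \<Longrightarrow> t < b \<Longrightarrow> S t < z"
        by (auto simp: eventually_at_right_field)
      then obtain t where t: "x < t" "S t < z"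
        using dense by blast
      have "?G x < ?G t"
        using t q_cdf by (simp add: strict_mono_less)
      also have "?G t \<le> ?F z"
        using t p.cdf_nondecreasing[of "S t" z] by (simp add: cdf_pushforward)
      finally show False
        using z by simp
    next
      case 2
      then have "eventually (\<lambda>t. z < S t) (at_left x)"
        using cont by (intro order_tendstoD(1)[of _ "S x"]) (auto simp: isCont_def intro: tendsto_within_subset)
      then obtain b where "b < x" and b: "\<And>t. b < t \<Longrightarrow> t < x \<Longrightarrow> z < S t"
        by (auto simp: eventually_at_left_field)
      then obtain t where t: "t < x" "z < S t"
        using dense by blast
      have "?G t < ?G x"
        using t q_cdf by (simp add: strict_mono_less)
      moreover have "?F z \<le> ?G t"
        using t p.cdf_nondecreasing[of z "S t"] by (simp add: cdf_pushforward)
      ultimately show False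
        using z by simp
    qed
  qed
qed (simp_all add: cdf_pushforward)

text \<open>Substituting \<open>y = S x\<close> on compact intervals shows that both sides are
  densities of the same measure, hence equal almost everywhere. More cannot be expected, as
  \<open>p\<close> is only a Borel version of its density.\<close>

lemma AE_pushforward_density: "AE x in lborel. p (S x) * S' x = q x"
proof -
  interpret q: real_distribution "dens_measure UNIV q" by (rule q_dist)
  note [measurable] = pushforward_measurable
  have p_nonneg: "0 \<le> p x" for x
    using push by (simp add: is_pushforward_def)
  have "dens_measure UNIV q = dens_measure UNIV (\<lambda>x. p (S x) * S' x)"
  proof (rule real_measure_eqI_Icc)
    fix a b :: real assume "a \<le> b"
    have "emeasure (dens_measure UNIV q) {a..b} = emeasure (dens_measure UNIV p) {S a..S b}"
      unfolding dens_measure_pushforward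
      by (simp add: emeasure_distr vimage_def pushforward_le_iff atLeastAtMost_def atLeast_def atMost_def
          Int_def)
    also have "\<dots> = (\<integral>\<^sup>+y. ennreal (p y * indicator {S a..S b} y) \<partial>lborel)"
      by (simp add: dens_measure_def emeasure_density nn_integral_set_ennreal)
    also have "\<dots> = (\<integral>\<^sup>+x. ennreal (p (S x) * S' x * indicator {a..b} x) \<partial>lborel)"
      by (rule nn_integral_substitution[OF _ S _ _ \<open>a \<le> b\<close>])
        (use S'_pos S'_cont in \<open>auto simp: set_borel_measurable_def less_imp_le intro: continuous_on_subset\<close>)
    also have "\<dots> = emeasure (dens_measure UNIV (\<lambda>x. p (S x) * S' x)) {a..b}"
      by (simp add: dens_measure_def emeasure_density nn_integral_set_ennreal)
    finally show "emeasure (dens_measure UNIV q) {a..b} =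
      emeasure (dens_measure UNIV (\<lambda>x. p (S x) * S' x)) {a..b}" .
  qed (auto simp: q.emeasure_eq_measure)
  then have "AE x in lborel. ennreal (q x) = ennreal (p (S x) * S' x)"
    using q.sigma_finite_measure_axioms
    by (subst sigma_finite_density_unique[symmetric]) (simp_all add: dens_measure_def)
  then show ?thesis
    by eventually_elim (simp add: q_nonneg p_nonneg S'_pos less_imp_le)
qed

text \<open>The transport map is \<open>S\<close>, so the argument of \<open>f\<close> is
  \<open>q x / p (S x)\<close>. Where \<open>q x\<close> is nonzero,
  \<open>p (S x) * S' x = q x\<close> makes the denominator nonzero and the ratio equal to
  \<open>S' x\<close>; where \<open>q x\<close> is zero both integrands vanish.\<close>

lemma transport_div_pushforward:
  assumes [measurable]: "f \<in> borel_measurable borel" and f: "\<And>u. 0 \<le> f u"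
  shows "transport_div UNIV f p q = enn2ereal (\<integral>\<^sup>+x. ennreal (f (S' x)) \<partial>dens_measure UNIV q)"
proof -
  note [measurable] = pushforward_measurable
  have "(\<integral>\<^sup>+x. ennreal (f (q x / p (S x)) * q x) \<partial>lborel) = (\<integral>\<^sup>+x. ennreal (f (S' x) * q x) \<partial>lborel)"
    using AE_pushforward_density
  proof (intro nn_integral_cong_AE, eventually_elim)
    case (elim x)
    show ?case
    proof (cases "q x = 0")
      case False
      with elim have "q x / p (S x) = S' x"
        by (auto simp: elim(2)[symmetric])
      then show ?thesis
        by simp
    qed simp
  qed
  then show ?thesis
    by (simp add: transport_div_def monotone_transport_pushforward ext_integral_nonneg
        nn_integral_dens_measure_UNIV f q_nonneg)
qed

end

text \<open>Collects, in order, what the preceding context asks of \<open>q\<close>, so that a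
  smooth density can be plugged in at once.\<close>

lemma dens_measure_smooth_density:
  assumes "q \<in> smooth_densities UNIV"
  shows "q \<in> borel_measurable borel" "0 \<le> q x" "real_distribution (dens_measure UNIV q)"
    "strict_mono (cdf (dens_measure UNIV q))"
proof -
  show "q \<in> borel_measurable borel"
    by (rule borel_measurable_continuous_onI, rule smooth_densitiesD(1)[OF assms])
  show "0 \<le> q x"
    by (rule less_imp_le) (rule smooth_densitiesD(2)[OF assms UNIV_I])
  show "real_distribution (dens_measure UNIV q)"
    by (rule real_distribution_dens_measure[OF assms]) simp
  show "strict_mono (cdf (dens_measure UNIV q))"
    by (rule strict_mono_cdf_dens_measure[OF assms])
qed

text \<open>The ratio is the derivative of the transport map; positivity and continuity are what the
  push-forward results require of \<open>S'\<close>.\<close>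

lemma
  assumes p: "p \<in> smooth_densities UNIV" and q: "q \<in> smooth_densities UNIV"
  shows density_ratio_pos: "0 < q x / p (monotone_transport UNIV p q x)"
    and continuous_on_density_ratio: "continuous_on A (\<lambda>x. q x / p (monotone_transport UNIV p q x))"
    and borel_measurable_monotone_transport: "monotone_transport UNIV p q \<in> borel_measurable borel"
proof -
  show "0 < q x / p (monotone_transport UNIV p q x)"
    by (simp add: smooth_densitiesD(2)[OF p] smooth_densitiesD(2)[OF q])
  have "continuous_on UNIV (\<lambda>x. q x / p (monotone_transport UNIV p q x))"
    using smooth_densitiesD(2)[OF p]
    by (intro continuous_on_divide smooth_densitiesD(1)[OF q] continuous_on_monotone_transport p q
        continuous_on_compose2[OF smooth_densitiesD(1)[OF p]]) (auto simp: less_imp_neq[THEN not_sym])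
  then show "continuous_on A (\<lambda>x. q x / p (monotone_transport UNIV p q x))"
    by (blast intro: continuous_on_subset)
  show "monotone_transport UNIV p q \<in> borel_measurable borel"
    by (intro borel_measurable_continuous_onI continuous_on_monotone_transport p q)
qed

text \<open>The set where \<open>g\<close> differs from \<open>c\<close> is open and Lebesgue-null,
  hence empty.\<close>

lemma AE_lborel_continuous_imp:
  fixes g :: "real \<Rightarrow> real"
  assumes "continuous_on UNIV g" "AE x in lborel. g x = c"
  shows "g x = c"
proof -
  have "open (g -` (- {c}))"
    using assms(1) by (intro open_vimage) auto
  moreover have "g -` (- {c}) \<in> null_sets lborel"
    using assms(2) \<open>open _\<close> by (subst AE_iff_null_sets) (auto elim: eventually_mono)
  then have "negligible (g -` (- {c}))"
    by (simp add: negligible_iff_null_sets null_sets_completionI)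
  ultimately have "g -` (- {c}) = {}"
    using open_not_negligible by blast
  then show ?thesis
    by auto
qed

subsection \<open>Properties of the transport divergence\<close>

text \<open>The distribution functions, one of them shifted by \<open>c\<close>, have the same
  derivative, so they differ by a constant; both tend to 1 at infinity, so it is 0. Hence the
  transport map is the shift by \<open>c\<close>, the ratio is 1, and
  \<open>f 1 = 0\<close>.\<close>

lemma transport_div_shift:
  assumes p: "p \<in> smooth_densities UNIV" and q: "q \<in> smooth_densities UNIV"
    and f: "div_generator f" and shift: "\<And>x. p (x + c) = q x"
  shows "transport_div UNIV f p q = 0"
proof -
  have "((\<lambda>x. cdf (dens_measure UNIV p) (x + c) - cdf (dens_measure UNIV q) x)
    has_real_derivative 0) (at x)" for x
    by (auto intro!: derivative_eq_intros DERIV_chain2[OF DERIV_cdf_dens_measure[OF p]]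
        DERIV_cdf_dens_measure[OF q] simp: shift)
  from DERIV_isconst_all[OF allI[OF this], of _ 0]
  obtain d where d: "cdf (dens_measure UNIV p) (x + c) - cdf (dens_measure UNIV q) x = d" for x
    by blast
  interpret p: real_distribution "dens_measure UNIV p"
    by (rule dens_measure_smooth_density[OF p])
  interpret q: real_distribution "dens_measure UNIV q"
    by (rule dens_measure_smooth_density[OF q])
  have "filterlim (\<lambda>x. x + c) at_top at_top"
    using filterlim_tendsto_add_at_top[OF tendsto_const filterlim_ident, of c] by (simp add: add.commute)
  then have "((\<lambda>x. cdf (dens_measure UNIV p) (x + c) - cdf (dens_measure UNIV q) x) \<longlongrightarrow> 1 - 1) at_top"
    by (intro tendsto_diff q.cdf_lim_at_top_prob filterlim_compose[OF p.cdf_lim_at_top_prob])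
  then have "d = 0"
    by (simp add: d tendsto_const_iff)
  then have T: "monotone_transport UNIV p q x = x + c" for x
    using d[of x] by (intro monotone_transport_unique p q) simp
  have "f (q x / p (monotone_transport UNIV p q x)) = 0" for x
    using smooth_densitiesD(2)[OF q, of x] by (simp add: T shift div_generatorD(4)[OF f])
  then show ?thesis
    by (simp add: transport_div_smooth[OF p q div_generatorD(2,3)[OF f]] zero_ennreal.rep_eq)
qed

text \<open>A vanishing nonnegative integral makes the integrand zero \<open>q\<close>-almost
  everywhere, hence Lebesgue-almost everywhere since \<open>q\<close> is positive. So the ratio is 1
  almost everywhere, by continuity everywhere, and the transport map has derivative 1.\<close>

lemma transport_div_eq_0D:
  assumes p: "p \<in> smooth_densities UNIV" and q: "q \<in> smooth_densities UNIV"
    and f: "div_generator f" "\<And>u. u \<noteq> 1 \<Longrightarrow> 0 < f u" and 0: "transport_div UNIV f p q = 0"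
  shows "\<exists>c. \<forall>x. p (x + c) = q x"
proof -
  let ?T = "monotone_transport UNIV p q"
  note [measurable] = div_generatorD(2)[OF f(1)] borel_measurable_monotone_transport[OF p q]
    dens_measure_smooth_density(1)[OF p] dens_measure_smooth_density(1)[OF q]
  have "(\<integral>\<^sup>+x. ennreal (f (q x / p (?T x))) \<partial>dens_measure UNIV q) = 0"
    using 0 unfolding transport_div_smooth[OF p q div_generatorD(2,3)[OF f(1)]]
    by (simp add: enn2ereal_inject[symmetric] zero_ennreal.rep_eq)
  moreover have "(\<lambda>x. ennreal (f (q x / p (?T x)))) \<in> borel_measurable (dens_measure UNIV q)"
    by measurable
  ultimately have "AE x in dens_measure UNIV q. ennreal (f (q x / p (?T x))) = 0"
    by (blast dest: nn_integral_0_iff_AE)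
  then have "AE x in lborel. 0 < ennreal (q x) \<longrightarrow> ennreal (f (q x / p (?T x))) = 0"
    unfolding dens_measure_def by (subst (asm) AE_density) simp_all
  then have "AE x in lborel. q x / p (?T x) = 1"
  proof eventually_elim
    case (elim x)
    then show ?case
      using smooth_densitiesD(2)[OF q, of x] f(2)[of "q x / p (?T x)"] by (force simp: ennreal_eq_0_iff)
  qed
  then have 1: "q x / p (?T x) = 1" for x
    by (rule AE_lborel_continuous_imp[OF continuous_on_density_ratio[OF p q]])
  then have "((\<lambda>x. ?T x - x) has_real_derivative 0) (at x)" for x
    using DERIV_monotone_transport[OF p q, of x] unfolding 1 by (auto intro!: derivative_eq_intros)
  from DERIV_isconst_all[OF allI[OF this], of _ 0]
  obtain c where c: "?T x - x = c" for x
    by blast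
  have "p (x + c) = q x" for x
    using 1[of x] c[of x] by (auto simp: divide_eq_1_iff algebra_simps)
  then show ?thesis
    by blast
qed

lemma transport_div_add_scale:
  assumes p: "p \<in> smooth_densities UNIV" and q: "q \<in> smooth_densities UNIV"
    and f: "div_generator f" and g: "div_generator g" and "0 \<le> a"
  shows "transport_div UNIV (\<lambda>u. f u + a * g u) p q =
    transport_div UNIV f p q + ereal a * transport_div UNIV g p q"
proof -
  note [measurable] = div_generatorD(2)[OF f] div_generatorD(2)[OF g] borel_measurable_monotone_transport[OF p q]
    dens_measure_smooth_density(1)[OF p] dens_measure_smooth_density(1)[OF q]
  show ?thesis
    using div_generatorD(3)[OF f] div_generatorD(3)[OF g] \<open>0 \<le> a\<close>
    by (simp add: transport_div_smooth[OF p q] ennreal_plus ennreal_mult nn_integral_add nn_integral_cmult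
        plus_ennreal.rep_eq times_ennreal.rep_eq)
qed

text \<open>At \<open>y = monotone_transport UNIV p q x\<close> the reverse transport returns
  \<open>x\<close>, so the ratio for the swapped pair is the reciprocal of the original one.\<close>

lemma transport_div_duality:
  assumes p: "p \<in> smooth_densities UNIV" and q: "q \<in> smooth_densities UNIV"
    and f: "div_generator f"
  shows "transport_div UNIV f p q = transport_div UNIV (\<lambda>u. f (1 / u)) q p"
proof -
  note [measurable] = div_generatorD(2)[OF f] borel_measurable_monotone_transport[OF p q]
    borel_measurable_monotone_transport[OF q p]
    dens_measure_smooth_density(1)[OF p] dens_measure_smooth_density(1)[OF q]
  have "(\<integral>\<^sup>+y. ennreal (f (1 / (p y / q (monotone_transport UNIV q p y)))) \<partial>dens_measure UNIV p) =
    (\<integral>\<^sup>+x. ennreal (f (q x / p (monotone_transport UNIV p q x))) \<partial>dens_measure UNIV q)"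
    unfolding distr_monotone_transport[OF p q, symmetric]
    by (subst nn_integral_distr) (simp_all add: monotone_transport_inverse[OF p q])
  then show ?thesis
    by (simp add: transport_div_smooth[OF p q] transport_div_smooth[OF q p] div_generatorD(3)[OF f])
qed

lemma transport_div_convex:
  assumes p1: "p1 \<in> smooth_densities UNIV" and p2: "p2 \<in> smooth_densities UNIV"
    and q: "q \<in> smooth_densities UNIV" and f: "div_generator f" and s: "0 \<le> s" "s \<le> 1"
    and push: "is_pushforward
      (\<lambda>x. s * monotone_transport UNIV p1 q x + (1 - s) * monotone_transport UNIV p2 q x) q ps"
  shows "transport_div UNIV f ps q \<le>
    ereal s * transport_div UNIV f p1 q + ereal (1 - s) * transport_div UNIV f p2 q"
proof -
  let ?r = "\<lambda>p x. q x / p (monotone_transport UNIV p q x)"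
  note [measurable] = div_generatorD(2)[OF f] dens_measure_smooth_density(1)[OF q]
    dens_measure_smooth_density(1)[OF p1] borel_measurable_monotone_transport[OF p1 q]
    dens_measure_smooth_density(1)[OF p2] borel_measurable_monotone_transport[OF p2 q]
  note f_nn = div_generatorD(3)[OF f]
  \<comment> \<open>Positivity of the derivative of the interpolated map. For \<open>s = 0\<close>
    the first summand vanishes and the second carries it.\<close>
  have "0 < s * ?r p1 x + (1 - s) * ?r p2 x" for x
  proof (cases "s = 0")
    case False
    then show ?thesis
      using s density_ratio_pos[OF p1 q] density_ratio_pos[OF p2 q]
      by (intro add_pos_nonneg mult_pos_pos mult_nonneg_nonneg less_imp_le[OF density_ratio_pos[OF p2 q]]) auto
  qed (use density_ratio_pos[OF p2 q] in simp)
  then have "transport_div UNIV f ps q =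
      enn2ereal (\<integral>\<^sup>+x. ennreal (f (s * ?r p1 x + (1 - s) * ?r p2 x)) \<partial>dens_measure UNIV q)"
    by (intro transport_div_pushforward[OF dens_measure_smooth_density[OF q] _ _ _ push] f_nn
        div_generatorD(2)[OF f] DERIV_add DERIV_cmult DERIV_monotone_transport
        continuous_on_add continuous_on_mult_left continuous_on_density_ratio p1 p2 q)
  \<comment> \<open>Pointwise convexity of \<open>f\<close>. \<open>convex_onD\<close> puts its
    parameter on the second point, hence the instance \<open>1 - s\<close>.\<close>
  also have "\<dots> \<le> enn2ereal (\<integral>\<^sup>+x. ennreal (s * f (?r p1 x) + (1 - s) * f (?r p2 x)) \<partial>dens_measure UNIV q)"
    unfolding less_eq_ennreal.rep_eq[symmetric]
    using f s convex_onD[of UNIV f "1 - s" "?r p1 _" "?r p2 _"]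
    by (intro nn_integral_mono ennreal_leI) (auto simp: div_generator_def)
  also have "\<dots> = ereal s * transport_div UNIV f p1 q + ereal (1 - s) * transport_div UNIV f p2 q"
    using f_nn s
    by (simp add: transport_div_smooth[OF p1 q] transport_div_smooth[OF p2 q] ennreal_plus
        ennreal_mult nn_integral_add nn_integral_cmult plus_ennreal.rep_eq times_ennreal.rep_eq)
  finally show ?thesis .
qed

text \<open>The preimage of an interval under \<open>inv k\<close> is its image under
  \<open>k\<close>, which contains a nondegenerate interval and so has positive
  \<open>q\<close>-mass. This replaces positivity of the density of the image measure, which is only
  a Borel version.\<close>

lemma strict_mono_cdf_distr_inv:
  fixes k :: "real \<Rightarrow> real"
  assumes q: "q \<in> smooth_densities UNIV" and k: "continuous_on UNIV k" "bij k"
    and inv_k [measurable]: "inv k \<in> borel_measurable borel"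
  shows "strict_mono (cdf (distr (dens_measure UNIV q) borel (inv k)))"
proof (rule strict_monoI)
  let ?M = "distr (dens_measure UNIV q) borel (inv k)"
  fix a b :: real assume "a < b"
  interpret q: real_distribution "dens_measure UNIV q"
    by (rule dens_measure_smooth_density[OF q])
  interpret M: real_distribution ?M
    by (intro q.real_distribution_distr) simp
  \<comment> \<open>Starting at the midpoint keeps the closed interval \<open>{m..b}\<close> inside
    \<open>{a<..b}\<close>. Taking \<open>min\<close> and \<open>max\<close> of the end values
    covers increasing and decreasing \<open>k\<close> alike.\<close>
  define m where "m = (a + b) / 2"
  have m: "a < m" "m < b"
    using \<open>a < b\<close> by (auto simp: m_def)
  define u v where "u = min (k m) (k b)" and "v = max (k m) (k b)"
  have "k m \<noteq> k b"
    using m bij_is_inj[OF k(2)] by (auto dest: injD)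
  then have "u < v"
    by (auto simp: u_def v_def)
  have "connected (k ` {m..b})"
    by (intro connected_continuous_image continuous_on_subset[OF k(1)]) auto
  then have "{u..v} \<subseteq> k ` {m..b}"
    using m by (intro connected_contains_Icc) (auto simp: u_def v_def min_def max_def)
  moreover have "inv k y \<in> {a<..b}" if "y \<in> k ` {m..b}" for y
    using that m(1) by (auto simp: inv_f_f[OF bij_is_inj[OF k(2)]])
  ultimately have "{u<..v} \<subseteq> inv k -` {a<..b}"
    by (auto simp: subset_iff)
  then have "emeasure (dens_measure UNIV q) {u<..v} \<le> emeasure (dens_measure UNIV q) (inv k -` {a<..b})"
    by (intro emeasure_mono) (simp_all add: measurable_sets_borel[OF inv_k])
  also have "\<dots> = emeasure ?M {a<..b}"
    by (simp add: emeasure_distr)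
  finally have "0 < emeasure ?M {a<..b}"
    using emeasure_dens_measure_Ioc_pos[OF q _ \<open>u < v\<close>] by simp
  then show "cdf ?M a < cdf ?M b"
    using M.cdf_diff_eq[OF \<open>a < b\<close>] by (simp add: M.emeasure_eq_measure)
qed

lemma DERIV_interval_integral:
  fixes g :: "real \<Rightarrow> real"
  assumes g: "continuous_on UNIV g"
  shows "((\<lambda>x. LBINT y=ereal a..ereal x. g y) has_real_derivative g x) (at x)"
proof -
  \<comment> \<open>The interval has to contain both \<open>a\<close> and \<open>x\<close>; the
    margin of 1 makes \<open>x\<close> interior, so the derivative within it is two-sided.\<close>
  define l u where "l = min a x - 1" and "u = max a x + 1"
  have "((\<lambda>x. LBINT y=ereal a..ereal x. g y) has_vector_derivative g x) (at x within {l..u})"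
    by (rule interval_integral_FTC2) (auto simp: l_def u_def intro: continuous_on_subset[OF g])
  moreover have "at x within {l..u} = at x"
    by (rule at_within_interior) (auto simp: l_def u_def min_def max_def)
  ultimately show ?thesis
    by (simp add: has_real_derivative_iff_has_vector_derivative)
qed

lemma transport_div_invariance:
  assumes p: "p \<in> smooth_densities UNIV" and q: "q \<in> smooth_densities UNIV"
    and f: "div_generator f" and k: "continuous_on UNIV k" "bij k"
    and push_q: "is_pushforward (inv k) q q'"
    and push_p: "is_pushforward
      (\<lambda>x. (LBINT y=ereal 0..ereal x. deriv (monotone_transport UNIV p q) (k y)) + c) q' p'"
  shows "transport_div UNIV f p q = transport_div UNIV f p' q'"
proof -
  let ?r = "\<lambda>x. q x / p (monotone_transport UNIV p q x)"
  have r: "deriv (monotone_transport UNIV p q) = ?r"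
    by (rule ext) (rule DERIV_imp_deriv[OF DERIV_monotone_transport[OF p q]])
  have k_inv [simp]: "k (inv k x) = x" for x
    by (simp add: bij_is_surj[OF k(2)] surj_f_inv_f)
  note [measurable] = div_generatorD(2)[OF f] dens_measure_smooth_density(1)[OF p]
    dens_measure_smooth_density(1)[OF q] borel_measurable_monotone_transport[OF p q]
    borel_measurable_continuous_onI[OF k(1)]
  have inv_k [measurable]: "inv k \<in> borel_measurable borel"
    and q': "q' \<in> borel_measurable borel" "\<And>x. 0 \<le> q' x"
    and dens_q': "dens_measure UNIV q' = distr (dens_measure UNIV q) borel (inv k)"
    using push_q by (auto simp: is_pushforward_def)
  interpret q: real_distribution "dens_measure UNIV q"
    by (rule dens_measure_smooth_density[OF q])
  have "real_distribution (dens_measure UNIV q')"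
    unfolding dens_q' by (intro q.real_distribution_distr) simp
  moreover have "strict_mono (cdf (dens_measure UNIV q'))"
    unfolding dens_q' by (rule strict_mono_cdf_distr_inv[OF q k inv_k])
  moreover have cont: "continuous_on UNIV (\<lambda>x. ?r (k x))"
    using continuous_on_compose2[OF continuous_on_density_ratio[OF p q, of UNIV] k(1)] by simp
  moreover have "((\<lambda>x. (LBINT y=ereal 0..ereal x. ?r (k y)) + c) has_real_derivative ?r (k x)) (at x)" for x
    using DERIV_add[OF DERIV_interval_integral[OF cont, of 0 x] DERIV_const[of c]] by simp
  ultimately have "transport_div UNIV f p' q' =
      enn2ereal (\<integral>\<^sup>+x. ennreal (f (?r (k x))) \<partial>dens_measure UNIV q')"
    using push_p unfolding r
    by (intro transport_div_pushforward[OF q'] density_ratio_pos[OF p q] div_generatorD(2,3)[OF f])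
  \<comment> \<open>The measure of \<open>q'\<close> is the image of \<open>q\<close> under
    \<open>inv k\<close>, so \<open>k\<close> cancels in the integrand.\<close>
  also have "(\<integral>\<^sup>+x. ennreal (f (?r (k x))) \<partial>dens_measure UNIV q') =
      (\<integral>\<^sup>+x. ennreal (f (?r x)) \<partial>dens_measure UNIV q)"
    unfolding dens_q' by (subst nn_integral_distr) simp_all
  finally show ?thesis
    by (simp add: transport_div_smooth[OF p q div_generatorD(2,3)[OF f]])
qed

section \<open>Uniform reference density on the unit interval\<close>

lemma AE_dens_measure_unit:
  assumes r: "r \<in> smooth_densities {0..1}"
  shows "AE x in dens_measure {0..1} r. 0 < x \<and> x \<le> 1"
  unfolding dens_measure_def
proof (subst AE_density)
  \<comment> \<open>Discarding the left endpoint makes the distribution function vanish at 0, and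
    not only to its left.\<close>
  show "AE x in lborel. 0 < ennreal (indicator {0..1} x * r x) \<longrightarrow> 0 < x \<and> x \<le> 1"
    using AE_lborel_singleton[of 0] by eventually_elim (auto simp: indicator_def split: if_splits)
qed (use borel_measurable_smooth_density[OF r] in simp)

lemma
  assumes r: "r \<in> smooth_densities {0..1}"
  shows cdf_unit_nonpos: "y \<le> 0 \<Longrightarrow> cdf (dens_measure {0..1} r) y = 0"
    and cdf_unit_ge_1: "1 \<le> y \<Longrightarrow> cdf (dens_measure {0..1} r) y = 1"
proof -
  interpret real_distribution "dens_measure {0..1} r"
    by (rule real_distribution_dens_measure[OF r]) simp
  note AE = AE_dens_measure_unit[OF r]
  show "cdf (dens_measure {0..1} r) y = 0" if "y \<le> 0"
    unfolding cdf_def using that by (subst prob_eq_0) (auto intro: eventually_mono[OF AE])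
  show "cdf (dens_measure {0..1} r) y = 1" if "1 \<le> y"
    unfolding cdf_def using that by (subst prob_eq_1) (auto intro: eventually_mono[OF AE])
qed

lemma const_1_smooth_density_unit: "(\<lambda>x. 1) \<in> smooth_densities {0..1}"
proof -
  have "smooth_on {0..1} (\<lambda>x. 1)"
    unfolding smooth_on_def by (rule exI[of _ "\<lambda>n x. if n = 0 then 1 else 0"]) auto
  then show ?thesis
    by (simp add: smooth_densities_def set_lebesgue_integral_def)
qed

lemma cdf_uniform_unit:
  assumes "0 \<le> x" "x \<le> 1"
  shows "cdf (dens_measure {0..1} (\<lambda>x. 1)) x = x"
proof -
  have "emeasure (dens_measure {0..1} (\<lambda>x. 1)) {..x} = (\<integral>\<^sup>+y. indicator {0..x} y \<partial>lborel)"
    unfolding dens_measure_def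
    by (subst emeasure_density, simp, simp, rule nn_integral_cong)
      (use assms in \<open>auto simp: indicator_def\<close>)
  then show ?thesis
    using assms by (simp add: cdf_def measure_def)
qed

text \<open>The uniform distribution function is the identity on the unit interval, so
  \<open>T\<close> inverts \<open>F\<close> there and pushes the uniform measure to
  \<open>r\<close>; the formula is the change of variables along \<open>T\<close>.\<close>

lemma transport_div_uniform:
  assumes r: "r \<in> smooth_densities {0..1}" and f: "div_generator f"
  shows "transport_div {0..1} f r (\<lambda>x. 1) = ext_integral {0..1} (\<lambda>x. f (1 / r x) * r x)"
proof -
  let ?U = "dens_measure {0..1} (\<lambda>x. 1)" and ?M = "dens_measure {0..1} r"
  define F T where "F = cdf ?M" and "T = monotone_transport {0..1} r (\<lambda>x. 1)"
  interpret M: real_distribution ?M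
    by (rule real_distribution_dens_measure[OF r]) simp
  interpret U: real_distribution ?U
    by (rule real_distribution_dens_measure[OF const_1_smooth_density_unit]) simp
  note [measurable] = borel_measurable_smooth_density[OF r, simplified] div_generatorD(2)[OF f]
  have F_less: "F x < F y \<longleftrightarrow> x < y" if "x \<in> {0..1}" "y \<in> {0..1}" for x y
    using that cdf_dens_measure_less[OF r, of x y] M.cdf_nondecreasing[of y x]
    by (fastforce simp: F_def not_less)
  have F_01: "F y \<in> {0..1}" for y
    by (simp add: F_def M.cdf_nonneg M.cdf_bounded_prob)
  have F_cont: "isCont F x" for x
    unfolding F_def by (rule isCont_cdf_dens_measure) (simp_all add: M.real_distribution_axioms)
  have F_image: "F ` {0..1} = {0..1}"
  proof (intro equalityI subsetI)
    fix u :: real assume "u \<in> {0..1}"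
    then have "\<exists>x\<ge>0. x \<le> 1 \<and> F x = u"
      using F_cont by (intro IVT) (auto simp: F_def cdf_unit_nonpos[OF r] cdf_unit_ge_1[OF r])
    then show "u \<in> F ` {0..1}"
      by auto
  qed (use F_01 in auto)
  have F_inj: "inj_on F {0..1}"
    by (rule inj_onI) (metis F_less less_irrefl linorder_neqE)
  have T_eq: "T x = inv_into {0..1} F x" if "x \<in> {0..1}" for x
    using that by (simp add: T_def monotone_transport_def F_def cdf_uniform_unit)
  have T_01: "T x \<in> {0..1}" and F_T: "F (T x) = x" if "x \<in> {0..1}" for x
    using that F_image by (metis T_eq inv_into_into, metis T_eq f_inv_into_f)
  have T_F: "T (F x) = x" if "x \<in> {0..1}" for x
    using T_eq[OF F_01] inv_into_f_f[OF F_inj that] by simp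
  \<comment> \<open>The inverse of a continuous injection on a compact set is continuous.\<close>
  have "continuous_on (F ` {0..1}) T"
    using F_cont T_F by (intro continuous_on_inv) (auto intro: continuous_at_imp_continuous_on)
  then have T_cont: "continuous_on {0..1} T"
    by (simp add: F_image)
  \<comment> \<open>Continuity of \<open>T\<close> is known on the unit interval; cutting off by 0
    outside gives a Borel map on the line that agrees with \<open>T\<close> almost everywhere for
    the uniform measure.\<close>
  define S where "S = (\<lambda>x. indicator {0..1} x * T x)"
  have [measurable]: "S \<in> borel_measurable borel"
    using borel_measurable_continuous_on_indicator[OF _ T_cont] by (simp add: S_def)
  have distr: "distr ?U borel S = ?M"
  proof (rule distr_eqI_cdf[where R=F])
    fix y
    show "AE x in ?U. S x \<le> y \<longleftrightarrow> x \<le> F y"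
      using AE_dens_measure_unit[OF const_1_smooth_density_unit]
    proof eventually_elim
      case (elim x)
      then have x: "x \<in> {0..1}" and S_x: "S x = T x"
        by (auto simp: S_def)
      \<comment> \<open>For \<open>y < 0\<close> both sides are false, as \<open>0 < x\<close> and
        \<open>F y = 0\<close>; for \<open>1 < y\<close> both are true. In between, \<open>F\<close>
        is strictly increasing and \<open>F (T x) = x\<close>.\<close>
      consider "y < 0" | "1 < y" | "y \<in> {0..1}"
        by fastforce
      then show ?case
      proof cases
        case 1
        then show ?thesis
          using T_01[OF x] elim by (simp add: S_x F_def cdf_unit_nonpos[OF r])
      next
        case 2
        then show ?thesis
          using T_01[OF x] elim by (simp add: S_x F_def cdf_unit_ge_1[OF r])
      next
        case 3
        then show ?thesis
          using F_less[OF 3 T_01[OF x]] by (simp add: S_x F_T[OF x] not_less[symmetric])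
      qed
    qed
    show "cdf ?U (F y) = cdf ?M y"
      using F_01[of y] by (simp add: cdf_uniform_unit) (simp add: F_def)
  qed (simp_all add: U.real_distribution_axioms M.real_distribution_axioms)
  \<comment> \<open>The values of \<open>r\<close> outside the unit interval are arbitrary;
    extension by 0 makes the integrand Borel on the whole line.\<close>
  define r' where "r' = (\<lambda>x. indicator {0..1} x * r x)"
  have [measurable]: "r' \<in> borel_measurable borel"
    by (simp add: r'_def)
  have r'_nonneg: "0 \<le> r' x" for x
    using smooth_densitiesD(2)[OF r, of x] by (auto simp: r'_def indicator_def)
  have "(\<integral>\<^sup>+x\<in>{0..1}. ennreal (f (1 / r (T x)) * 1) \<partial>lborel) =
      (\<integral>\<^sup>+x. ennreal (indicator {0..1} x * 1) * ennreal (f (1 / r' (S x))) \<partial>lborel)"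
    using T_01 by (intro nn_integral_cong) (simp add: indicator_def r'_def S_def)
  also have "\<dots> = (\<integral>\<^sup>+x. ennreal (f (1 / r' (S x))) \<partial>?U)"
    unfolding dens_measure_def by (rule nn_integral_density[symmetric]) measurable
  also have "\<dots> = (\<integral>\<^sup>+y. ennreal (f (1 / r' y)) \<partial>?M)"
    unfolding distr[symmetric] by (subst nn_integral_distr) simp_all
  also have "\<dots> = (\<integral>\<^sup>+y. ennreal (r' y) * ennreal (f (1 / r' y)) \<partial>lborel)"
    unfolding dens_measure_def by (subst nn_integral_density) (simp_all add: r'_def)
  also have "\<dots> = (\<integral>\<^sup>+y\<in>{0..1}. ennreal (f (1 / r y) * r y) \<partial>lborel)"
    using div_generatorD(3)[OF f] smooth_densitiesD(2)[OF r]
    by (intro nn_integral_cong) (simp add: r'_def indicator_def ennreal_mult less_imp_le mult.commute)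
  finally have eq: "(\<integral>\<^sup>+x\<in>{0..1}. ennreal (f (1 / r (T x)) * 1) \<partial>lborel) =
      (\<integral>\<^sup>+y\<in>{0..1}. ennreal (f (1 / r y) * r y) \<partial>lborel)" .
  have "transport_div {0..1} f r (\<lambda>x. 1) = ext_integral {0..1} (\<lambda>x. f (1 / r (T x)) * 1)"
    by (simp only: transport_div_def T_def)
  also have "\<dots> = enn2ereal (\<integral>\<^sup>+y\<in>{0..1}. ennreal (f (1 / r y) * r y) \<partial>lborel)"
    unfolding eq[symmetric] by (rule ext_integral_nonneg) (simp add: div_generatorD(3)[OF f])
  also have "\<dots> = ext_integral {0..1} (\<lambda>x. f (1 / r x) * r x)"
    using div_generatorD(3)[OF f] less_imp_le[OF smooth_densitiesD(2)[OF r]]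
    by (intro ext_integral_nonneg[symmetric] mult_nonneg_nonneg)
  finally show ?thesis .
qed

theorem mainTheorem2:
  fixes f p q T :: "real \<Rightarrow> real"
  assumes "div_generator f"
    and "p \<in> smooth_densities UNIV"
    and "q \<in> smooth_densities UNIV"
    and "T = monotone_transport UNIV p q"
  shows
    "(0 \<le> transport_div UNIV f p q \<and>
      ((\<exists>c. \<forall>x. p (x + c) = q x) \<longrightarrow> transport_div UNIV f p q = 0) \<and>
      ((\<forall>u. u \<noteq> 1 \<longrightarrow> 0 < f u) \<longrightarrow>
        (transport_div UNIV f p q = 0 \<longleftrightarrow> (\<exists>c. \<forall>x. p (x + c) = q x)))) \<and>
     (\<forall>r \<in> smooth_densities {0..1}.
        transport_div {0..1} f r (\<lambda>x. 1) = ext_integral {0..1} (\<lambda>x. f (1 / r x) * r x)) \<and>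
     (\<forall>f1 f2 a. div_generator f1 \<and> div_generator f2 \<and> 0 < a \<longrightarrow>
        transport_div UNIV (\<lambda>u. f1 u + a * f2 u) p q =
          transport_div UNIV f1 p q + ereal a * transport_div UNIV f2 p q) \<and>
     transport_div UNIV f p q = transport_div UNIV (\<lambda>u. f (1 / u)) q p \<and>
     (\<forall>k c q' p'. smooth_on UNIV k \<and> bij k \<and> is_pushforward (inv k) q q' \<and>
        is_pushforward (\<lambda>x. (LBINT y=ereal 0..ereal x. deriv T (k y)) + c) q' p' \<longrightarrow>
        transport_div UNIV f p q = transport_div UNIV f p' q') \<and>
     (\<forall>p1 \<in> smooth_densities UNIV. \<forall>p2 \<in> smooth_densities UNIV. \<forall>s \<in> {0..1}. \<forall>ps.
        is_pushforward
          (\<lambda>x. s * monotone_transport UNIV p1 q x + (1 - s) * monotone_transport UNIV p2 q x) q ps \<longrightarrow>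
        transport_div UNIV f ps q \<le>
          ereal s * transport_div UNIV f p1 q + ereal (1 - s) * transport_div UNIV f p2 q)"
proof (intro conjI impI allI ballI; (elim conjE)?)
  note f = assms(1) and p = assms(2) and q = assms(3)
  show "0 \<le> transport_div UNIV f p q"
    unfolding transport_div_smooth[OF p q div_generatorD(2,3)[OF f]] by (rule enn2ereal_nonneg)
  show shift: "transport_div UNIV f p q = 0" if "\<exists>c. \<forall>x. p (x + c) = q x"
    using that transport_div_shift[OF p q f] by blast
  \<comment> \<open>The forward direction uses positivity of \<open>f\<close> away from 1; the
    converse is \<open>shift\<close>.\<close>
  show "transport_div UNIV f p q = 0 \<longleftrightarrow> (\<exists>c. \<forall>x. p (x + c) = q x)"
    if "\<forall>u. u \<noteq> 1 \<longrightarrow> 0 < f u"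
    using that shift transport_div_eq_0D[OF p q f] by blast
  show "transport_div {0..1} f r (\<lambda>x. 1) = ext_integral {0..1} (\<lambda>x. f (1 / r x) * r x)"
    if "r \<in> smooth_densities {0..1}" for r
    by (rule transport_div_uniform[OF that f])
  show "transport_div UNIV (\<lambda>u. f1 u + a * f2 u) p q =
      transport_div UNIV f1 p q + ereal a * transport_div UNIV f2 p q"
    if "div_generator f1" "div_generator f2" "0 < a" for f1 f2 a
    by (rule transport_div_add_scale[OF p q that(1,2) less_imp_le[OF that(3)]])
  show "transport_div UNIV f p q = transport_div UNIV (\<lambda>u. f (1 / u)) q p"
    by (rule transport_div_duality[OF p q f])
  show "transport_div UNIV f p q = transport_div UNIV f p' q'"
    if "smooth_on UNIV k" "bij k" "is_pushforward (inv k) q q'"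
      "is_pushforward (\<lambda>x. (LBINT y=ereal 0..ereal x. deriv T (k y)) + c) q' p'" for k c q' p'
    by (rule transport_div_invariance[OF p q f smooth_on_imp_continuous_on[OF that(1)]
          that(2-4)[unfolded assms(4)]])
  show "transport_div UNIV f ps q \<le>
      ereal s * transport_div UNIV f p1 q + ereal (1 - s) * transport_div UNIV f p2 q"
    if "p1 \<in> smooth_densities UNIV" "p2 \<in> smooth_densities UNIV" "s \<in> {0..1}"
      "is_pushforward
        (\<lambda>x. s * monotone_transport UNIV p1 q x + (1 - s) * monotone_transport UNIV p2 q x) q ps"
    for p1 p2 s ps
    using transport_div_convex[OF that(1,2) q f _ _ that(4)] that(3) by simp
qed

end
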